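(* Let $c>0$ and $\alpha>3$, and let $(x_k)$ be a sequence in $\mathcal H$ generated from arbitrary $x_0,x_1\in\mathcal H$ by the algorithm (IPATRE): for $k\ge1$, $$y_k=x_k+\left(1-\frac{\alpha}{k}\right)(x_k-x_{k-1}),\qquad x_{k+1}=\operatorname{prox}_f\left(y_k-\frac{c}{k^2}x_k\right).$$ Then for all $s\in\left[\frac12,1\right[$ the following hold: (i) $f(x_k)-\min_{\mathcal H} f=o(k^{-2s})$, $\|x_k-x_{k-1}\|=o(k^{-s})$ and $\|\nabla f(x_k)\|=o(k^{-s})$ as $k\to+\infty$. (ii) $\displaystyle\sum_{k=1}^{+\infty}k^{2s-1}\big(f(x_k)-\min_{\mathcal H} f\big)<+\infty$, $\displaystyle\sum_{k=1}^{+\infty}k^{2s-1}\|x_k-x_{k-1}\|^2<+\infty$, and $\displaystyle\sum_{k=1}^{+\infty}k^{2s}\|\nabla f(x_k)\|^2<+\infty$.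
   Context: $\mathcal H$ is a real Hilbert space with norm $\|\cdot\|$. The function $f:\mathcal H\to\mathbb R$ is convex and differentiable, $\nabla f$ is Lipschitz continuous on bounded sets, and $\operatorname{argmin} f\ne\emptyset$. $\operatorname{prox}_f(x)=\operatorname{argmin}_{z\in\mathcal H}\{f(z)+\frac12\|z-x\|^2\}$; equivalently the iteration reads $x_{k+1}=\alpha_k(x_k-x_{k-1})-\nabla f(x_{k+1})+(1-\frac{c}{k^2})x_k$ with $\alpha_k=1-\frac{\alpha}{k}$. *)

theory Defs
  imports "HOL-Analysis.Analysis" "HOL-Library.Landau_Symbols"
begin

text \<open>
  On a Hilbert space the vector selected below exists for every (Frechet) differentiable
  function by the Riesz representation theorem, and it is unique.
\<close>

definition gradient :: "('a::real_inner \<Rightarrow> real) \<Rightarrow> 'a \<Rightarrow> 'a" where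
  "gradient f x = (THE D. GDERIV f x :> D)"

definition argmin_set :: "('a \<Rightarrow> real) \<Rightarrow> 'a set" where
  "argmin_set f = {x. is_arg_min f (\<lambda>_. True) x}"

text \<open>
  For convex continuous \<open>f\<close> on a Hilbert space the minimised function is strongly convex and
  continuous, so its minimiser exists and is unique; the choice made by \<open>arg_min\<close> is
  then immaterial.
\<close>

definition prox :: "('a::real_inner \<Rightarrow> real) \<Rightarrow> 'a \<Rightarrow> 'a" where
  "prox f x = arg_min (\<lambda>z. f z + 1 / 2 * (norm (z - x))\<^sup>2) (\<lambda>_. True)"

end

theory Submission
  imports Defs
begin

text \<open>
  Write \<open>d k = x k - x (k - 1)\<close>, \<open>g k\<close> for the gradient of \<open>f\<close> at \<open>x k\<close>, and fix a
  minimiser \<open>z\<close> of \<open>f\<close>. The optimality condition of the proximal step says that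
  \<open>g (k + 1)\<close> is the prox argument minus \<open>x (k + 1)\<close>, and that this vector is a subgradient
  (\<open>gradient_prox\<close>, \<open>prox_subgradient\<close>). Hence
  \<open>d (k + 1) = (1 - \<alpha>/k) d k - g (k + 1) - (c/k\<^sup>2) x k\<close>, an implicit discretisation of
  \<open>x'' + (\<alpha>/t) x' + \<nabla>f(x) + (c/t\<^sup>2) x = 0\<close>.

  For \<open>2 < b < \<alpha> - 1\<close>, an interval that is nonempty because \<open>\<alpha> > 3\<close>, consider the energy
  \<open>E k = k (k + 1 - \<alpha>) (f (x k) - f z) + \<parallel>b (x k - z) + (k - \<alpha>) d k\<parallel>\<^sup>2 / 2
  + b (\<alpha> - 1 - b) / 2 \<parallel>x k - z\<parallel>\<^sup>2 + c/2 \<parallel>x k\<parallel>\<^sup>2\<close>.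
  It dominates both \<open>k\<^sup>2 (f (x k) - f z)\<close> and \<open>k\<^sup>2 \<parallel>d k\<parallel>\<^sup>2\<close> up to constants. The choice of
  \<open>b\<close> makes the contributions of the function values and of the velocity to the increment of \<open>E\<close>
  nonpositive for large \<open>k\<close>. The implicit step contributes \<open>- k\<^sup>2 \<parallel>g (k + 1)\<parallel>\<^sup>2 / 4\<close>. The
  Tikhonov term pulls towards \<open>0\<close> instead of \<open>z\<close>, and the price is at most
  \<open>b c \<parallel>z\<parallel>\<^sup>2 / (2 k)\<close>. So, eventually (\<open>energy_step\<close>),
  \<open>E (k + 1) + k\<^sup>2 \<parallel>g (k + 1)\<parallel>\<^sup>2 / 4 \<le> E k + C / k\<close>.

  The error \<open>C / k\<close> just fails to be summable, but multiplying by \<open>k powr q\<close> with any \<open>q < 0\<close>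
  makes it so, and since the weight decreases the inequality still telescopes
  (\<open>weighted_energy_bound\<close>). Therefore \<open>E k = O(k powr (- q))\<close> for every \<open>q < 0\<close>, which
  yields the rates and the sums for values and velocities for every \<open>s < 1\<close>. The choice
  \<open>q = 2 s - 2\<close> gives the summability of \<open>k powr (2 s) * \<parallel>g k\<parallel>\<^sup>2\<close>, whose terms
  then tend to \<open>0\<close>.
\<close>

section \<open>The proximal step\<close>

lemma norm_midpoint_power2:
  fixes a b p :: "'a::real_inner"
  shows "(norm ((1/2) *\<^sub>R a + (1/2) *\<^sub>R b - p))\<^sup>2
    = (norm (a - p))\<^sup>2 / 2 + (norm (b - p))\<^sup>2 / 2 - (norm (a - b))\<^sup>2 / 4"
  by (simp add: power2_norm_eq_inner inner_simps inner_commute field_simps)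

text \<open>
  By the parallelogram identity the quadratic term gains \<open>\<parallel>a - b\<parallel>\<^sup>2 / 8\<close> at midpoints, so two
  points whose values are both near the infimum must be near each other. A minimising sequence is
  therefore Cauchy, and its limit is a minimiser.
\<close>
lemma prox_objective_has_minimiser:
  fixes f :: "'a::{real_inner, complete_space} \<Rightarrow> real"
  assumes convex: "convex_on UNIV f" and cont: "continuous_on UNIV f"
    and lower: "\<And>w. m0 \<le> f w"
  shows "\<exists>q. \<forall>w. f q + 1/2 * (norm (q - p))\<^sup>2 \<le> f w + 1/2 * (norm (w - p))\<^sup>2"
proof -
  define h where "h = (\<lambda>w. f w + 1/2 * (norm (w - p))\<^sup>2)"
  define m where "m = (INF w. h w)"
  have bdd: "bdd_below (range h)"
    by (rule bdd_belowI[of _ m0]) (auto simp: h_def intro: add_increasing2 lower)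
  have m_le: "m \<le> h w" for w
    unfolding m_def using bdd by (rule cINF_lower) simp
  have gap: "(norm (a - b))\<^sup>2 / 4 \<le> (h a - m) + (h b - m)" for a b
  proof -
    have "f ((1/2) *\<^sub>R a + (1/2) *\<^sub>R b) \<le> (1/2) * f a + (1/2) * f b"
      using convex_onD[OF convex, of "1/2" a b] by simp
    with m_le[of "(1/2) *\<^sub>R a + (1/2) *\<^sub>R b"] show ?thesis
      unfolding h_def norm_midpoint_power2 by (simp add: algebra_simps)
  qed
  have "\<exists>w. h w < m + 1 / real (Suc n)" for n
    using cINF_less_iff[OF _ bdd, of "m + 1 / real (Suc n)"] by (auto simp: m_def)
  then obtain w where w: "\<And>n. h (w n) < m + 1 / real (Suc n)" by metis
  have "Cauchy w"
  proof (rule metric_CauchyI)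
    fix e :: real assume e: "e > 0"
    obtain N where N: "1 / real (Suc N) < e\<^sup>2 / 8"
      using nat_approx_posE[of "e\<^sup>2/8"] e by auto
    have close: "h (w n) - m < e\<^sup>2 / 8" if "n \<ge> N" for n
    proof -
      have "1 / real (Suc n) \<le> 1 / real (Suc N)" using that by (simp add: field_simps)
      with w[of n] N show ?thesis by linarith
    qed
    have "dist (w i) (w j) < e" if "i \<ge> N" "j \<ge> N" for i j
    proof -
      have "(norm (w i - w j))\<^sup>2 < e\<^sup>2"
        using gap[of "w i" "w j"] close[OF that(1)] close[OF that(2)] by linarith
      then show ?thesis using e by (simp add: dist_norm power_less_imp_less_base)
    qed
    then show "\<exists>N. \<forall>i\<ge>N. \<forall>j\<ge>N. dist (w i) (w j) < e" by blast
  qed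
  then obtain q where q: "w \<longlonglongrightarrow> q" using Cauchy_convergent_iff convergent_def by blast
  have "continuous_on UNIV h" unfolding h_def by (intro continuous_intros cont)
  then have "(\<lambda>n. h (w n)) \<longlonglongrightarrow> h q"
    using continuous_on_tendsto_compose[OF _ q, of UNIV h] by simp
  moreover have "(\<lambda>n. m + 1 / real (Suc n)) \<longlonglongrightarrow> m + 0"
    by (intro tendsto_intros LIMSEQ_Suc lim_1_over_n)
  ultimately have "h q \<le> m + 0"
    by (rule LIMSEQ_le) (use w less_imp_le in blast)
  then have "h q \<le> h w" for w using m_le[of w] by simp
  then show ?thesis unfolding h_def by blast
qed

lemma prox_minimises:
  fixes f :: "'a::{real_inner, complete_space} \<Rightarrow> real"
  assumes "convex_on UNIV f" "continuous_on UNIV f" "\<And>w. m0 \<le> f w"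
  shows "f (prox f p) + 1/2 * (norm (prox f p - p))\<^sup>2 \<le> f w + 1/2 * (norm (w - p))\<^sup>2"
proof -
  obtain q where q: "\<forall>w. f q + 1/2 * (norm (q - p))\<^sup>2 \<le> f w + 1/2 * (norm (w - p))\<^sup>2"
    using prox_objective_has_minimiser[OF assms] by blast
  show ?thesis unfolding prox_def
    by (rule arg_minI[where x = q]) (use q in \<open>auto simp: not_less\<close>)
qed

lemma norm_add_scaleR_power2:
  fixes a v :: "'a::real_inner"
  shows "(norm (a + t *\<^sub>R v))\<^sup>2 = (norm a)\<^sup>2 + 2 * t * inner a v + t\<^sup>2 * (norm v)\<^sup>2"
  by (simp add: power2_norm_eq_inner inner_simps inner_commute power2_eq_square[of t] algebra_simps)

text \<open>
  Compare the minimiser with a point at parameter \<open>t\<close> of the segment towards \<open>w\<close>: convexity bounds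
  \<open>f\<close> there linearly in \<open>t\<close>, while the quadratic term differs from its linear part only by
  \<open>O(t\<^sup>2)\<close>. Dividing by \<open>t\<close> and letting \<open>t\<close> tend to \<open>0\<close> leaves the subgradient inequality.
\<close>
lemma prox_subgradient:
  fixes f :: "'a::{real_inner, complete_space} \<Rightarrow> real"
  assumes convex: "convex_on UNIV f" and "continuous_on UNIV f" "\<And>w. m0 \<le> f w"
  shows "f (prox f p) + inner (p - prox f p) (w - prox f p) \<le> f w"
proof -
  let ?q = "prox f p"
  let ?v = "w - ?q"
  have chord: "f ?q + inner (p - ?q) ?v - f w \<le> t * ((norm ?v)\<^sup>2 / 2)" if t: "0 < t" "t < 1" for t
  proof -
    let ?r = "(1 - t) *\<^sub>R ?q + t *\<^sub>R w"
    have c: "f ?r \<le> (1 - t) * f ?q + t * f w"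
      using convex_onD[OF convex, of t ?q w] t by simp
    have "?r - p = (?q - p) + t *\<^sub>R ?v" by (simp add: algebra_simps)
    then have "(norm (?r - p))\<^sup>2 = (norm (?q - p))\<^sup>2 + 2 * t * inner (?q - p) ?v + t\<^sup>2 * (norm ?v)\<^sup>2"
      by (simp only: norm_add_scaleR_power2)
    moreover have "inner (?q - p) ?v = - inner (p - ?q) ?v"
      by (simp add: inner_diff_left)
    ultimately have "(norm (?r - p))\<^sup>2
        = (norm (?q - p))\<^sup>2 - 2 * t * inner (p - ?q) ?v + t\<^sup>2 * (norm ?v)\<^sup>2"
      by simp
    with c prox_minimises[OF assms, of p ?r]
    have "t * (f ?q + inner (p - ?q) ?v - f w) \<le> t * (t * ((norm ?v)\<^sup>2 / 2))"
      by (simp add: algebra_simps power2_eq_square)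
    then show ?thesis using t by simp
  qed
  have "((\<lambda>t. t * ((norm ?v)\<^sup>2 / 2)) \<longlongrightarrow> 0 * ((norm ?v)\<^sup>2 / 2)) (at_right 0)"
    by (intro tendsto_intros)
  moreover have "\<forall>\<^sub>F t in at_right (0::real). f ?q + inner (p - ?q) ?v - f w \<le> t * ((norm ?v)\<^sup>2 / 2)"
    unfolding eventually_at_right_field using chord by (intro exI[of _ 1]) auto
  ultimately have "f ?q + inner (p - ?q) ?v - f w \<le> 0 * ((norm ?v)\<^sup>2 / 2)"
    by (rule tendsto_lowerbound) simp
  then show ?thesis by simp
qed

lemma gradient_unique:
  assumes "GDERIV f a :> g" shows "gradient f a = g"
  unfolding gradient_def
proof (rule the_equality)
  show "GDERIV f a :> g" by (fact assms)
next
  fix D assume "GDERIV f a :> D"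
  with assms have "(\<lambda>h. inner h D) = (\<lambda>h. inner h g)"
    unfolding gderiv_def using has_derivative_unique by blast
  then have "inner (D - g) (D - g) = 0"
    by (simp add: inner_diff_right fun_eq_iff)
  then show "D = g" by simp
qed

text \<open>
  The subgradient inequality says that \<open>f\<close> minus a linear functional is minimal at the proximal
  point, so its derivative vanishes there; that functional therefore represents the derivative of
  \<open>f\<close>.
\<close>
lemma gradient_prox:
  fixes f :: "'a::{real_inner, complete_space} \<Rightarrow> real"
  assumes diff: "f differentiable (at (prox f p))"
    and prox: "convex_on UNIV f" "continuous_on UNIV f" "\<And>w. m0 \<le> f w"
  shows "gradient f (prox f p) = p - prox f p"
proof (rule gradient_unique)
  let ?q = "prox f p"
  obtain f' where f': "(f has_derivative f') (at ?q)"
    using diff by (auto simp: differentiable_def)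
  have "((\<lambda>w. f w - inner (p - ?q) w) has_derivative (\<lambda>h. f' h - inner (p - ?q) h)) (at ?q)"
    by (intro derivative_intros f')
  moreover have "f ?q - inner (p - ?q) ?q \<le> f w - inner (p - ?q) w" for w
    using prox_subgradient[OF prox, of p w] by (simp add: inner_diff_right)
  ultimately have "(\<lambda>h. f' h - inner (p - ?q) h) = (\<lambda>h. 0)"
    by (intro differential_zero_maxmin[of ?q UNIV]) auto
  then have "f' = (\<lambda>h. inner h (p - ?q))"
    by (auto simp: fun_eq_iff inner_commute)
  with f' show "GDERIV f ?q :> p - ?q" by (simp add: gderiv_def)
qed

section \<open>Dissipation of the energy\<close>

text \<open>
  The arguments \<open>K\<close>, \<open>\<phi>\<close>, \<open>X\<close>, \<open>D\<close> stand for the index, the gap \<open>f (x k) - f z\<close>, the iterate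
  and the last increment. With the factor \<open>K - \<alpha>\<close> in front of \<open>D\<close>, the increment of the vector
  inside the norm along the iteration is a combination of the new increment, the gradient and the
  Tikhonov term alone; the weight \<open>K * (K + 1 - \<alpha>)\<close> is the one for which the inner products of
  gradient and increment cancel.
\<close>
definition energy ::
    "real \<Rightarrow> real \<Rightarrow> real \<Rightarrow> 'a::real_inner \<Rightarrow> real \<Rightarrow> real \<Rightarrow> 'a \<Rightarrow> 'a \<Rightarrow> real" where
  "energy \<alpha> b c z K \<phi> X D = K * (K + 1 - \<alpha>) * \<phi>
     + (norm (b *\<^sub>R (X - z) + (K - \<alpha>) *\<^sub>R D))\<^sup>2 / 2
     + b * (\<alpha> - 1 - b) / 2 * (norm (X - z))\<^sup>2 + c / 2 * (norm X)\<^sup>2"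

lemma norm_add_power2_lower:
  fixes a r :: "'a::real_inner"
  shows "(norm a)\<^sup>2 / 2 - (norm r)\<^sup>2 \<le> (norm (a + r))\<^sup>2"
proof -
  have "0 \<le> (norm (a + 2 *\<^sub>R r))\<^sup>2" by simp
  then show ?thesis
    by (simp add: power2_norm_eq_inner inner_simps inner_commute)
qed

lemma norm_add_power2_upper:
  fixes a r :: "'a::real_inner"
  shows "(norm (a + r))\<^sup>2 \<le> 2 * (norm a)\<^sup>2 + 2 * (norm r)\<^sup>2"
proof -
  have "0 \<le> (norm (a - r))\<^sup>2" by simp
  then show ?thesis
    by (simp add: power2_norm_eq_inner inner_simps inner_commute)
qed

text \<open>
  One step from \<open>X\<close> to \<open>Y\<close>, where \<open>G\<close> is the gradient at \<open>Y\<close>, and \<open>\<phi>\<close>, \<open>\<psi>\<close> are the gaps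
  before and after. The first-order terms either cancel or are absorbed: \<open>b > 2\<close> lets the
  subgradient inequality at \<open>z\<close> outweigh the growth of the weight of the gap, and \<open>\<beta> > 0\<close>
  provides damping of order \<open>K \<parallel>d\<parallel>\<^sup>2\<close> against the quadratic remainders. The two lower bounds
  on \<open>K\<close> besides \<open>K \<ge> 1\<close> are what absorbing the terms in \<open>\<parallel>X\<parallel>\<^sup>2\<close> and \<open>\<parallel>d\<parallel>\<^sup>2\<close> requires.
\<close>
lemma energy_step:
  fixes X Y D G z :: "'a::real_inner"
  assumes b: "2 < b" and \<beta>: "\<beta> = \<alpha> - 1 - b" "\<beta> > 0" and c: "c > 0"
    and K: "K \<ge> 1" "4 * c / b \<le> K" "\<beta>\<^sup>2 + c * \<beta>\<^sup>2 / b + c / 2 \<le> \<beta> * (K + 1 - \<alpha>)"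
    and rec: "Y - X = (1 - \<alpha> / K) *\<^sub>R D - G - (c / K\<^sup>2) *\<^sub>R X"
    and sub_X: "\<psi> - inner G (Y - X) \<le> \<phi>"
    and sub_z: "\<psi> \<le> inner G (Y - z)" and \<psi>: "0 \<le> \<psi>"
  shows "energy \<alpha> b c z (K + 1) \<psi> Y (Y - X) + K\<^sup>2 / 4 * (norm G)\<^sup>2
    \<le> energy \<alpha> b c z K \<phi> X D + b * c / 2 * (norm z)\<^sup>2 / K"
proof -
  define d where "d = Y - X"
  define u where "u = Y - z"
  define v0 where "v0 = b *\<^sub>R (X - z) + (K - \<alpha>) *\<^sub>R D"
  define v1 where "v1 = b *\<^sub>R u + (K + 1 - \<alpha>) *\<^sub>R d"
  define w where "w = \<beta> *\<^sub>R d + (K *\<^sub>R G + (c / K) *\<^sub>R X)"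
  define \<kappa> where "\<kappa> = b * c / K"
  define \<zeta> where "\<zeta> = c * (K + 1 - \<alpha>) / K"
  define p where "p = K * (K + 1 - \<alpha>)"
  have K0: "K > 0" using K by simp
  have b0: "b > 0" using b by simp
  have "K *\<^sub>R d = K *\<^sub>R ((1 - \<alpha> / K) *\<^sub>R D - G - (c / K\<^sup>2) *\<^sub>R X)"
    unfolding d_def rec ..
  also have "\<dots> = (K - \<alpha>) *\<^sub>R D - K *\<^sub>R G - (c / K) *\<^sub>R X"
    using K0 by (simp add: scaleR_diff_right right_diff_distrib power2_eq_square)
  finally have Kd: "(K - \<alpha>) *\<^sub>R D = K *\<^sub>R d + K *\<^sub>R G + (c / K) *\<^sub>R X"
    by (simp add: algebra_simps)
  \<comment> \<open>The recursion replaces the old increment by the new one, so that both energies are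
    expressed through the same vectors.\<close>
  have v: "v0 = v1 + w"
    unfolding v0_def v1_def w_def Kd u_def d_def \<beta>(1) by (simp add: algebra_simps)
  have p0: "p \<ge> 0"
  proof -
    have "0 \<le> \<beta>\<^sup>2 + c * \<beta>\<^sup>2 / b + c / 2" using b0 c by simp
    with K(3) have "0 \<le> \<beta> * (K + 1 - \<alpha>)" by linarith
    with \<beta>(2) K0 show ?thesis by (simp add: p_def zero_le_mult_iff)
  qed
  have A: "(K + 1) * (K + 2 - \<alpha>) * \<psi> - p * \<phi> \<le> (2 * K + 2 - \<alpha>) * \<psi> + p * inner G d"
  proof -
    have "p * (\<psi> - inner G d) \<le> p * \<phi>"
      using sub_X p0 unfolding d_def by (rule mult_left_mono)
    then show ?thesis by (simp add: p_def algebra_simps)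
  qed
  have w_lower: "K\<^sup>2 / 2 * (norm G)\<^sup>2 - 2 * \<beta>\<^sup>2 * (norm d)\<^sup>2 - 2 * (c / K)\<^sup>2 * (norm X)\<^sup>2 \<le> (norm w)\<^sup>2"
  proof -
    have "w = K *\<^sub>R G + (\<beta> *\<^sub>R d + (c / K) *\<^sub>R X)" by (simp add: w_def)
    with norm_add_power2_lower[of "K *\<^sub>R G" "\<beta> *\<^sub>R d + (c / K) *\<^sub>R X"]
      norm_add_power2_upper[of "\<beta> *\<^sub>R d" "(c / K) *\<^sub>R X"]
    show ?thesis by (simp add: power_mult_distrib power_divide)
  qed
  have B: "(norm v1)\<^sup>2 / 2 - (norm v0)\<^sup>2 / 2 = - inner v1 w - (norm w)\<^sup>2 / 2"
    unfolding v by (simp add: power2_norm_eq_inner inner_simps inner_commute field_simps)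
  have C: "inner v1 w = b * \<beta> * inner u d + b * K * inner u G + \<kappa> * inner u X
      + \<beta> * (K + 1 - \<alpha>) * (norm d)\<^sup>2 + p * inner G d + \<zeta> * inner d X"
    unfolding v1_def w_def p_def \<kappa>_def \<zeta>_def using K0
    by (simp add: power2_norm_eq_inner inner_simps inner_commute field_simps)
  have D: "b * \<beta> / 2 * (norm u)\<^sup>2 - b * \<beta> / 2 * (norm (X - z))\<^sup>2
      = b * \<beta> * inner u d - b * \<beta> / 2 * (norm d)\<^sup>2"
  proof -
    have "X - z = u - d" by (simp add: u_def d_def)
    show ?thesis unfolding \<open>X - z = u - d\<close>
      by (simp add: power2_norm_eq_inner inner_simps inner_commute algebra_simps)
  qed
  have E: "c / 2 * (norm Y)\<^sup>2 - c / 2 * (norm X)\<^sup>2 = c * inner d X + c / 2 * (norm d)\<^sup>2"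
    unfolding d_def by (simp add: power2_norm_eq_inner inner_simps inner_commute algebra_simps)
  \<comment> \<open>This is where the error of order \<open>1 / K\<close> arises: the Tikhonov term is the gradient of
    a multiple of \<open>\<parallel>x\<parallel>\<^sup>2 / 2\<close>, whose value at \<open>z\<close> enters through the convexity inequality
    \<open>inner x (z - x) \<le> \<parallel>z\<parallel>\<^sup>2 / 2 - \<parallel>x\<parallel>\<^sup>2 / 2\<close>.\<close>
  have tikhonov: "- (\<kappa> * inner u X)
      \<le> - (\<kappa> * inner d X) - \<kappa> / 2 * (norm X)\<^sup>2 + \<kappa> / 2 * (norm z)\<^sup>2"
  proof -
    have "0 \<le> (norm (X - z))\<^sup>2" by simp
    then have "- inner u X \<le> - inner d X - (norm X)\<^sup>2 / 2 + (norm z)\<^sup>2 / 2"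
      unfolding u_def d_def by (simp add: power2_norm_eq_inner inner_simps inner_commute)
    then have "\<kappa> * (- inner u X)
        \<le> \<kappa> * (- inner d X - (norm X)\<^sup>2 / 2 + (norm z)\<^sup>2 / 2)"
      using b0 c K0 unfolding \<kappa>_def by (intro mult_left_mono) auto
    then show ?thesis by (simp add: algebra_simps)
  qed
  have G: "b * K * \<psi> \<le> b * K * inner u G"
    using sub_z b0 K0 by (simp add: u_def inner_commute)
  have coef: "c - \<zeta> - \<kappa> = c * \<beta> / K"
    using K0 by (simp add: \<beta>(1) \<kappa>_def \<zeta>_def field_simps)
  have H: "c * \<beta> / K * inner d X \<le> \<kappa> / 4 * (norm X)\<^sup>2 + c * \<beta>\<^sup>2 / b * (norm d)\<^sup>2"
  proof -
    \<comment> \<open>Young's inequality, balanced so that half of the available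
      \<open>b c / (2 K) \<parallel>X\<parallel>\<^sup>2\<close> is used; the other half serves \<open>X_coef\<close>.\<close>
    have "0 \<le> (norm ((b/2) *\<^sub>R X - \<beta> *\<^sub>R d))\<^sup>2" by simp
    then have "b * \<beta> * inner d X \<le> b\<^sup>2 / 4 * (norm X)\<^sup>2 + \<beta>\<^sup>2 * (norm d)\<^sup>2"
      by (simp add: power2_norm_eq_inner inner_simps inner_commute power2_eq_square[of b]
          power2_eq_square[of \<beta>] algebra_simps)
    then have "c / (b * K) * (b * \<beta> * inner d X)
        \<le> c / (b * K) * (b\<^sup>2 / 4 * (norm X)\<^sup>2 + \<beta>\<^sup>2 * (norm d)\<^sup>2)"
      using b0 c K0 by (intro mult_left_mono) auto
    also have "\<dots> = \<kappa> / 4 * (norm X)\<^sup>2 + c * \<beta>\<^sup>2 / b * (norm d)\<^sup>2 / K"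
      using b0 K0 by (simp add: \<kappa>_def field_simps power2_eq_square)
    also have "\<dots> \<le> \<kappa> / 4 * (norm X)\<^sup>2 + c * \<beta>\<^sup>2 / b * (norm d)\<^sup>2"
    proof -
      have "0 \<le> c * \<beta>\<^sup>2 / b * (norm d)\<^sup>2" using b0 c by simp
      then have "c * \<beta>\<^sup>2 / b * (norm d)\<^sup>2 / K \<le> c * \<beta>\<^sup>2 / b * (norm d)\<^sup>2 / 1"
        using K(1) by (intro divide_left_mono) auto
      then show ?thesis by simp
    qed
    finally show ?thesis using b0 K0 by (simp add: field_simps)
  qed
  have X_coef: "(c / K)\<^sup>2 * (norm X)\<^sup>2 \<le> \<kappa> / 4 * (norm X)\<^sup>2"
  proof (rule mult_right_mono)
    have "c \<le> b * K / 4" using K(2) b0 by (simp add: field_simps)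
    then have "c * c / K\<^sup>2 \<le> c * (b * K / 4) / K\<^sup>2"
      using c by (intro divide_right_mono mult_left_mono) auto
    also have "\<dots> = \<kappa> / 4" using K0 by (simp add: \<kappa>_def field_simps power2_eq_square)
    finally show "(c / K)\<^sup>2 \<le> \<kappa> / 4" by (simp add: power_divide power2_eq_square)
  qed simp
  have d_coef: "(\<beta>\<^sup>2 + c * \<beta>\<^sup>2 / b + c / 2) * (norm d)\<^sup>2 \<le> \<beta> * (K + 1 - \<alpha>) * (norm d)\<^sup>2"
    using K(3) by (rule mult_right_mono) simp
  have d_extra: "0 \<le> b * \<beta> / 2 * (norm d)\<^sup>2" using b0 \<beta>(2) by simp
  have \<psi>_coef: "(2 * K + 2 - \<alpha>) * \<psi> \<le> b * K * \<psi>"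
  proof (rule mult_right_mono[OF _ \<psi>])
    have "2 * K \<le> b * K" using b K0 by simp
    then show "2 * K + 2 - \<alpha> \<le> b * K" using b \<beta> by linarith
  qed
  have cross: "c * inner d X - \<zeta> * inner d X - \<kappa> * inner d X
      = c * \<beta> / K * inner d X"
    unfolding coef[symmetric] by (simp add: algebra_simps)
  have "(K + 1) * (K + 2 - \<alpha>) * \<psi> + (norm v1)\<^sup>2 / 2 + b * \<beta> / 2 * (norm u)\<^sup>2 + c / 2 * (norm Y)\<^sup>2
      + K\<^sup>2 / 4 * (norm G)\<^sup>2
    \<le> p * \<phi> + (norm v0)\<^sup>2 / 2 + b * \<beta> / 2 * (norm (X - z))\<^sup>2 + c / 2 * (norm X)\<^sup>2
      + \<kappa> / 2 * (norm z)\<^sup>2"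
    using A B C D E G tikhonov H X_coef d_coef[unfolded distrib_right] d_extra \<psi>_coef cross w_lower
    by linarith
  moreover have "energy \<alpha> b c z (K + 1) \<psi> Y (Y - X) = (K + 1) * (K + 2 - \<alpha>) * \<psi>
      + (norm v1)\<^sup>2 / 2 + b * \<beta> / 2 * (norm u)\<^sup>2 + c / 2 * (norm Y)\<^sup>2"
    by (simp add: energy_def v1_def u_def d_def \<beta>(1))
  moreover have "energy \<alpha> b c z K \<phi> X D
      = p * \<phi> + (norm v0)\<^sup>2 / 2 + b * \<beta> / 2 * (norm (X - z))\<^sup>2 + c / 2 * (norm X)\<^sup>2"
    by (simp add: energy_def v0_def p_def \<beta>(1))
  moreover have "b * c / 2 * (norm z)\<^sup>2 / K = \<kappa> / 2 * (norm z)\<^sup>2"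
    by (simp add: \<kappa>_def)
  ultimately show ?thesis by linarith
qed

lemma energy_nonneg:
  assumes "0 < b" "b < \<alpha> - 1" "c > 0" "\<alpha> \<le> K + 1" "0 \<le> K" "0 \<le> \<phi>"
  shows "0 \<le> energy \<alpha> b c z K \<phi> X D"
  unfolding energy_def using assms by (intro add_nonneg_nonneg mult_nonneg_nonneg) auto

lemma energy_controls_value:
  assumes b: "0 < b" "b < \<alpha> - 1" and c: "c > 0" and K: "2 * \<alpha> \<le> K" and \<phi>: "0 \<le> \<phi>"
  shows "K\<^sup>2 * \<phi> \<le> 2 * energy \<alpha> b c z K \<phi> X D"
proof -
  have "K / 2 \<le> K + 1 - \<alpha>" "0 \<le> K" using b K by linarith+
  then have "K * (K / 2) * \<phi> \<le> K * (K + 1 - \<alpha>) * \<phi>"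
    using \<phi> by (intro mult_right_mono mult_left_mono) auto
  moreover have "0 \<le> b * (\<alpha> - 1 - b) / 2 * (norm (X - z))\<^sup>2" "0 \<le> c / 2 * (norm X)\<^sup>2"
    "0 \<le> (norm (b *\<^sub>R (X - z) + (K - \<alpha>) *\<^sub>R D))\<^sup>2 / 2"
    using b c by auto
  ultimately have "K * (K / 2) * \<phi> \<le> energy \<alpha> b c z K \<phi> X D"
    unfolding energy_def by linarith
  then show ?thesis by (simp add: power2_eq_square)
qed

text \<open>
  The velocity is the mixed term of the energy minus a multiple of \<open>X - z\<close>, and the distance term
  of the energy controls the latter; this needs \<open>b < \<alpha> - 1\<close> strictly.
\<close>
lemma energy_controls_velocity:
  assumes b: "0 < b" "b < \<alpha> - 1" and c: "c > 0" and K: "2 * \<alpha> \<le> K" and \<phi>: "0 \<le> \<phi>"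
  shows "K\<^sup>2 * (norm D)\<^sup>2 \<le> 16 * (1 + b / (\<alpha> - 1 - b)) * energy \<alpha> b c z K \<phi> X D"
proof -
  define \<beta> where "\<beta> = \<alpha> - 1 - b"
  define u where "u = X - z"
  define v where "v = b *\<^sub>R u + (K - \<alpha>) *\<^sub>R D"
  let ?E = "energy \<alpha> b c z K \<phi> X D"
  have \<beta>: "\<beta> > 0" using b by (simp add: \<beta>_def)
  have "0 \<le> K * (K + 1 - \<alpha>) * \<phi>" using b K \<phi> by (intro mult_nonneg_nonneg) auto
  moreover have "0 \<le> c / 2 * (norm X)\<^sup>2" using c by simp
  moreover have "0 \<le> b * \<beta> / 2 * (norm u)\<^sup>2" using b \<beta> by simp
  moreover have "?E = K * (K + 1 - \<alpha>) * \<phi> + (norm v)\<^sup>2 / 2 + b * \<beta> / 2 * (norm u)\<^sup>2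
      + c / 2 * (norm X)\<^sup>2"
    by (simp add: energy_def v_def u_def \<beta>_def)
  moreover have "0 \<le> (norm v)\<^sup>2" by simp
  ultimately have v: "(norm v)\<^sup>2 \<le> 2 * ?E" and u: "b * \<beta> / 2 * (norm u)\<^sup>2 \<le> ?E"
    by linarith+
  have "b / \<beta> * (b * \<beta> / 2 * (norm u)\<^sup>2) \<le> b / \<beta> * ?E"
    using b \<beta> by (intro mult_left_mono u) auto
  then have u': "b\<^sup>2 * (norm u)\<^sup>2 \<le> 2 * (b / \<beta> * ?E)"
    using \<beta> by (simp add: power2_eq_square mult.assoc mult.commute mult.left_commute)
  have "(K / 2)\<^sup>2 * (norm D)\<^sup>2 \<le> (K - \<alpha>)\<^sup>2 * (norm D)\<^sup>2"
    using b K by (intro mult_right_mono power_mono) auto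
  also have "\<dots> = (norm (v + (- b) *\<^sub>R u))\<^sup>2"
    by (simp add: v_def power_mult_distrib)
  also have "\<dots> \<le> 2 * (norm v)\<^sup>2 + 2 * (b\<^sup>2 * (norm u)\<^sup>2)"
    using norm_add_power2_upper[of v "(- b) *\<^sub>R u"] by (simp add: power_mult_distrib)
  also have "\<dots> \<le> 4 * ?E + 4 * (b / \<beta> * ?E)" using v u' by linarith
  finally have "K\<^sup>2 * (norm D)\<^sup>2 \<le> 4 * (4 * ?E + 4 * (b / \<beta> * ?E))"
    by (simp add: power_divide)
  also have "\<dots> = 16 * (1 + b / \<beta>) * ?E" by (simp add: algebra_simps)
  finally show ?thesis by (simp add: \<beta>_def)
qed

section \<open>From the recursive inequality to rates\<close>

text \<open>
  Since \<open>k powr q\<close> decreases, \<open>k powr q * E k\<close> satisfies the same recursive inequality with error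
  \<open>C * k powr (q - 1)\<close>, which is summable.
\<close>
lemma weighted_energy_bound:
  fixes E e :: "nat \<Rightarrow> real"
  assumes N: "N \<ge> 1" and nonneg: "\<And>k. k \<ge> N \<Longrightarrow> 0 \<le> E k"
    and step: "\<And>k. k \<ge> N \<Longrightarrow> E (Suc k) + e k \<le> E k + C / real k"
    and C: "C \<ge> 0" and q: "q < 0"
  shows "\<exists>M. \<forall>n\<ge>N. real n powr q * E n + (\<Sum>k=N..<n. real k powr q * e k) \<le> M"
proof (intro exI allI impI)
  let ?a = "\<lambda>k. real k powr (q - 1)"
  have summ: "summable ?a" using q by (simp add: summable_real_powr_iff)
  fix n assume "n \<ge> N"
  then have "real n powr q * E n + (\<Sum>k=N..<n. real k powr q * e k)
      \<le> real N powr q * E N + C * (\<Sum>k=N..<n. ?a k)"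
  proof (induction n rule: dec_induct)
    case base
    show ?case by simp
  next
    case (step n)
    have n0: "real n > 0" using step N by simp
    have "real (Suc n) powr q * E (Suc n) \<le> real n powr q * E (Suc n)"
      using nonneg[of "Suc n"] step n0 q by (intro mult_right_mono powr_mono2') auto
    moreover have "real n powr q * (E (Suc n) + e n) \<le> real n powr q * (E n + C / real n)"
      using assms(3)[of n] step by (intro mult_left_mono) auto
    moreover have "real n powr q * (C / real n) = C * ?a n"
      using n0 by (simp add: powr_diff)
    ultimately show ?case using step by (simp add: algebra_simps)
  qed
  also have "\<dots> \<le> real N powr q * E N + C * suminf ?a"
    using C summ by (intro add_left_mono mult_left_mono sum_le_suminf) auto
  finally show "real n powr q * E n + (\<Sum>k=N..<n. real k powr q * e k)
      \<le> real N powr q * E N + C * suminf ?a" .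
qed

lemma summable_if_partial_sums_bounded_from:
  fixes a :: "nat \<Rightarrow> real"
  assumes nonneg: "\<And>k. 0 \<le> a k" and bound: "\<And>n. n \<ge> N \<Longrightarrow> (\<Sum>k=N..<n. a k) \<le> M"
  shows "summable a"
proof -
  have "(\<Sum>k<n. a (k + N)) \<le> M" for n
    using bound[of "n + N"] sum.shift_bounds_nat_ivl[of a 0 N n] by (simp add: atLeast0LessThan)
  then have "summable (\<lambda>k. a (k + N))"
    by (intro summableI_nonneg_bounded[of _ M]) (auto simp: nonneg)
  then show ?thesis by (simp add: summable_iff_shift)
qed

lemma summable_on_from_1_if_summable:
  fixes a :: "nat \<Rightarrow> real"
  assumes "\<And>k. 0 \<le> a k" "summable a"
  shows "a summable_on {1..}"
proof -
  have "a summable_on UNIV" using assms by (simp add: summable_on_UNIV_nonneg_real_iff)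
  then show ?thesis by (rule summable_on_subset_banach) simp
qed

text \<open>
  For \<open>q = s - 1\<close>, halfway between \<open>0\<close> and \<open>2 * s - 2\<close>, the bound reads \<open>a = O(k powr (- 1 - s))\<close>, and \<open>- 1 - s < - 2 * s\<close>
  as well as \<open>(2 * s - 1) + (- 1 - s) < - 1\<close>.
\<close>
lemma rates_of_almost_quadratic_decay:
  fixes a :: "nat \<Rightarrow> real"
  assumes nonneg: "\<And>k. 0 \<le> a k" and s: "s < 1"
    and bound: "\<And>q. q < 0 \<Longrightarrow> \<exists>M. \<forall>k\<ge>N. real k powr q * ((real k)\<^sup>2 * a k) \<le> M"
  shows "a \<in> o(\<lambda>k. real k powr (- 2 * s))"
    and "(\<lambda>k. real k powr (2 * s - 1) * a k) summable_on {1..}"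
proof -
  obtain M where M: "\<And>k. k \<ge> N \<Longrightarrow> real k powr (s - 1) * ((real k)\<^sup>2 * a k) \<le> M"
    using bound[of "s - 1"] s by auto
  have big: "a \<in> O(\<lambda>k. real k powr (- 1 - s))"
  proof (rule bigoI)
    show "\<forall>\<^sub>F k in sequentially. norm (a k) \<le> M * norm (real k powr (- 1 - s))"
      using eventually_ge_at_top[of "max 1 N"]
    proof eventually_elim
      case (elim k)
      then have k: "real k > 0" by simp
      have "real k powr (- 1 - s) * (real k powr (s - 1) * real k powr 2) = 1"
        using k unfolding powr_add[symmetric] by simp
      then have "a k = real k powr (- 1 - s) * (real k powr (s - 1) * ((real k)\<^sup>2 * a k))"
        using k by (simp add: mult.assoc[symmetric])
      also have "\<dots> \<le> real k powr (- 1 - s) * M"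
        using M[of k] elim by (intro mult_left_mono) auto
      finally show ?case using nonneg[of k] by (simp add: mult.commute)
    qed
  qed
  have "(\<lambda>k. real k powr (- 1 - s)) \<in> o(\<lambda>k. real k powr (- 2 * s))"
    using s by (subst powr_smallo_iff) (auto simp: filterlim_real_sequentially)
  with big show "a \<in> o(\<lambda>k. real k powr (- 2 * s))" by (rule landau_o.big_small_trans)
  have "real k powr (2 * s - 1) * real k powr (- 1 - s) = real k powr (s - 2)" for k
    unfolding powr_add[symmetric] by (rule arg_cong[where f = "\<lambda>r. real k powr r"]) simp
  then have "(\<lambda>k. real k powr (2 * s - 1) * a k) \<in> O(\<lambda>k. real k powr (s - 2))"
    using landau_o.big.mult_left[OF big, of "\<lambda>k. real k powr (2 * s - 1)"] by (simp only:)
  moreover have "summable (\<lambda>k. norm (real k powr (s - 2)))"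
    using s summable_real_powr_iff[of "s - 2"] by simp
  ultimately have "summable (\<lambda>k. real k powr (2 * s - 1) * a k)"
    by (rule summable_comparison_test_bigo[rotated])
  then show "(\<lambda>k. real k powr (2 * s - 1) * a k) summable_on {1..}"
    by (intro summable_on_from_1_if_summable) (simp_all add: nonneg)
qed

lemma smallo_powr_of_power2:
  fixes a :: "nat \<Rightarrow> real"
  assumes "(\<lambda>k. (a k)\<^sup>2) \<in> o(\<lambda>k. real k powr (- 2 * s))"
  shows "a \<in> o(\<lambda>k. real k powr (- s))"
proof (rule landau_o.smallI)
  fix e :: real assume e: "e > 0"
  have "\<forall>\<^sub>F k in sequentially. norm ((a k)\<^sup>2) \<le> e\<^sup>2 * norm (real k powr (- 2 * s))"
    using assms e by (intro landau_o.smallD) auto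
  then show "\<forall>\<^sub>F k in sequentially. norm (a k) \<le> e * norm (real k powr (- s))"
  proof eventually_elim
    case (elim k)
    have "real k powr (- 2 * s) = (real k powr (- s))\<^sup>2"
      by (simp add: power2_eq_square powr_add[symmetric])
    with elim have "(a k)\<^sup>2 \<le> (e * real k powr (- s))\<^sup>2"
      by (simp add: power_mult_distrib)
    then show ?case using e by (simp add: power2_le_iff_abs_le)
  qed
qed

text \<open>
  The energy inequality pairs the index \<open>k\<close> with the gradient at \<open>k + 1\<close>. Passing to matching
  indices costs a constant factor, because \<open>k + 1 \<le> 2 * k\<close>.
\<close>
lemma rates_of_weighted_summability:
  fixes a :: "nat \<Rightarrow> real"
  assumes nonneg: "\<And>k. 0 \<le> a k" and s: "0 \<le> s" "s \<le> 1"
    and summ: "summable (\<lambda>k. real k powr (2 * s - 2) * ((real k)\<^sup>2 * a (Suc k)))"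
  shows "a \<in> o(\<lambda>k. real k powr (- 2 * s))"
    and "(\<lambda>k. real k powr (2 * s) * a k) summable_on {1..}"
proof -
  have shift: "real (Suc k) powr (2 * s) * a (Suc k)
      \<le> 4 * (real k powr (2 * s - 2) * ((real k)\<^sup>2 * a (Suc k)))" if "k \<ge> 1" for k
  proof -
    have k: "real k > 0" using that by simp
    have "real (Suc k) powr (2 * s) \<le> (2 * real k) powr (2 * s)"
      using that s by (intro powr_mono2) auto
    also have "\<dots> = 2 powr (2 * s) * real k powr (2 * s)" by (simp add: powr_mult)
    also have "\<dots> \<le> 2 powr 2 * real k powr (2 * s)"
      using s by (intro mult_right_mono powr_mono) auto
    also have "\<dots> = 4 * (real k powr (2 * s - 2) * (real k)\<^sup>2)"
      using k by (simp add: powr_diff)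
    finally have "real (Suc k) powr (2 * s) * a (Suc k)
        \<le> 4 * (real k powr (2 * s - 2) * (real k)\<^sup>2) * a (Suc k)"
      using nonneg by (rule mult_right_mono)
    then show ?thesis by (simp add: mult.assoc)
  qed
  have "summable (\<lambda>k. real (Suc k) powr (2 * s) * a (Suc k))"
    by (rule summable_comparison_test[OF _ summable_mult[OF summ, of 4]])
      (use shift nonneg in \<open>auto intro!: exI[of _ 1]\<close>)
  then have summ': "summable (\<lambda>k. real k powr (2 * s) * a k)"
    using summable_Suc_iff[of "\<lambda>k. real k powr (2 * s) * a k"] by simp
  then show "(\<lambda>k. real k powr (2 * s) * a k) summable_on {1..}"
    by (intro summable_on_from_1_if_summable) (simp_all add: nonneg)
  show "a \<in> o(\<lambda>k. real k powr (- 2 * s))"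
  proof (rule smalloI_tendsto)
    have "(\<lambda>k. a k / real k powr (- 2 * s)) = (\<lambda>k. real k powr (2 * s) * a k)"
      by (simp add: powr_minus divide_inverse mult.commute)
    then show "(\<lambda>k. a k / real k powr (- 2 * s)) \<longlonglongrightarrow> 0"
      using summable_LIMSEQ_zero[OF summ'] by (simp only:)
    show "\<forall>\<^sub>F k in sequentially. real k powr (- 2 * s) \<noteq> 0"
      using eventually_gt_at_top[of 0] by eventually_elim simp
  qed
qed

section \<open>Convergence rates of the algorithm\<close>

theorem theorem12:
  fixes f :: "'a::{real_inner, complete_space} \<Rightarrow> real"
    and x y :: "nat \<Rightarrow> 'a"
    and c \<alpha> :: real
  assumes convex: "convex_on UNIV f"
    and differentiable: "\<And>z. f differentiable (at z)"
    and lipschitz: "\<And>B. bounded B \<Longrightarrow> \<exists>L. L-lipschitz_on B (gradient f)"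
    and argmin: "argmin_set f \<noteq> {}"
    and c: "c > 0"
    and \<alpha>: "\<alpha> > 3"
    and y: "\<And>k. k \<ge> 1 \<Longrightarrow> y k = x k + (1 - \<alpha> / real k) *\<^sub>R (x k - x (k - 1))"
    and x: "\<And>k. k \<ge> 1 \<Longrightarrow> x (k + 1) = prox f (y k - (c / (real k)\<^sup>2) *\<^sub>R x k)"
  shows "\<forall>s\<in>{1/2..<1::real}.
      ((\<lambda>k. f (x k) - (INF z. f z)) \<in> o(\<lambda>k. real k powr (- 2 * s)) \<and>
       (\<lambda>k. norm (x k - x (k - 1))) \<in> o(\<lambda>k. real k powr (- s)) \<and>
       (\<lambda>k. norm (gradient f (x k))) \<in> o(\<lambda>k. real k powr (- s))) \<and>
      (\<lambda>k. real k powr (2 * s - 1) * (f (x k) - (INF z. f z))) summable_on {1..} \<and>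
      (\<lambda>k. real k powr (2 * s - 1) * (norm (x k - x (k - 1)))\<^sup>2) summable_on {1..} \<and>
      (\<lambda>k. real k powr (2 * s) * (norm (gradient f (x k)))\<^sup>2) summable_on {1..}"
proof -
  obtain z where z: "z \<in> argmin_set f" using argmin by blast
  then have f_min: "f z \<le> f w" for w
    by (auto simp: argmin_set_def is_arg_min_def not_less)
  then have Inf_f: "(INF w. f w) = f z"
    by (intro cInf_eq_minimum) auto
  have cont: "continuous_on UNIV f"
    using differentiable by (simp add: continuous_at_imp_continuous_on differentiable_imp_continuous_within)
  note prox = convex cont f_min
  define g where "g = (\<lambda>k. gradient f (x k))"
  define d where "d = (\<lambda>k. x k - x (k - 1))"
  define \<phi> where "\<phi> = (\<lambda>k. f (x k) - f z)"
  have \<phi>_nonneg: "0 \<le> \<phi> k" for k by (simp add: \<phi>_def f_min)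
  have g: "g (Suc k) = (y k - (c / (real k)\<^sup>2) *\<^sub>R x k) - x (Suc k)" if "k \<ge> 1" for k
    using gradient_prox[OF differentiable prox] x[OF that] by (simp add: g_def)
  have subgrad: "f (x (Suc k)) + inner (g (Suc k)) (w - x (Suc k)) \<le> f w" if "k \<ge> 1" for k w
    using prox_subgradient[OF prox, of "y k - (c / (real k)\<^sup>2) *\<^sub>R x k" w] x[OF that] g[OF that]
    by simp
  have rec: "x (Suc k) - x k = (1 - \<alpha> / real k) *\<^sub>R d k - g (Suc k) - (c / (real k)\<^sup>2) *\<^sub>R x k"
    if "k \<ge> 1" for k
    using g[OF that] y[OF that] by (simp add: d_def)

  \<comment> \<open>The midpoint of the interval from \<open>2\<close> to \<open>\<alpha> - 1\<close>.\<close>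
  define b where "b = (\<alpha> + 1) / 2"
  define \<beta> where "\<beta> = \<alpha> - 1 - b"
  have b: "2 < b" "0 < b" "b < \<alpha> - 1" and \<beta>: "\<beta> > 0"
    using \<alpha> by (simp_all add: b_def \<beta>_def field_simps)
  define E where "E = (\<lambda>k. energy \<alpha> b c z (real k) (\<phi> k) (x k) (d k))"
  define T where "T = \<beta>\<^sup>2 + c * \<beta>\<^sup>2 / b + c / 2"
  obtain N :: nat where N': "max (2 * \<alpha>) (max (4 * c / b) (T / \<beta> + \<alpha>)) \<le> real N"
    using real_arch_simple by blast
  have large: "k \<ge> 1" "2 * \<alpha> \<le> real k" "4 * c / b \<le> real k" "T \<le> \<beta> * (real k + 1 - \<alpha>)"
    if "k \<ge> N" for k
  proof -
    have k: "real N \<le> real k" using that by simp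
    show "2 * \<alpha> \<le> real k" "4 * c / b \<le> real k" using k N' by simp_all
    then show "k \<ge> 1" using \<alpha> by (cases k) auto
    have "T / \<beta> \<le> real k + 1 - \<alpha>" using k N' by simp
    then show "T \<le> \<beta> * (real k + 1 - \<alpha>)" using \<beta> by (simp add: field_simps)
  qed
  have E_nonneg: "0 \<le> E k" if "k \<ge> N" for k
    unfolding E_def using large[OF that] b c \<alpha> \<phi>_nonneg by (intro energy_nonneg) auto
  have E_step: "E (Suc k) + (real k)\<^sup>2 / 4 * (norm (g (Suc k)))\<^sup>2
      \<le> E k + (b * c / 2 * (norm z)\<^sup>2) / real k" if "k \<ge> N" for k
  proof -
    have k: "k \<ge> 1" using large[OF that] by simp
    have "energy \<alpha> b c z (real k + 1) (\<phi> (Suc k)) (x (Suc k)) (x (Suc k) - x k)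
        + (real k)\<^sup>2 / 4 * (norm (g (Suc k)))\<^sup>2
        \<le> energy \<alpha> b c z (real k) (\<phi> k) (x k) (d k) + b * c / 2 * (norm z)\<^sup>2 / real k"
    proof (rule energy_step[OF b(1) \<beta>_def \<beta> c _ _ _ rec[OF k]])
      show "1 \<le> real k" "4 * c / b \<le> real k"
        "\<beta>\<^sup>2 + c * \<beta>\<^sup>2 / b + c / 2 \<le> \<beta> * (real k + 1 - \<alpha>)"
        using large[OF that] by (simp_all add: T_def)
      show "\<phi> (Suc k) - inner (g (Suc k)) (x (Suc k) - x k) \<le> \<phi> k"
        using subgrad[OF k, of "x k"] by (simp add: \<phi>_def inner_diff_right)
      show "\<phi> (Suc k) \<le> inner (g (Suc k)) (x (Suc k) - z)"
        using subgrad[OF k, of z] by (simp add: \<phi>_def inner_diff_right)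
    qed (rule \<phi>_nonneg)
    then show ?thesis by (simp add: E_def d_def add.commute)
  qed
  have weighted: "\<exists>M. \<forall>n\<ge>N. real n powr q * E n
      + (\<Sum>k=N..<n. real k powr q * ((real k)\<^sup>2 / 4 * (norm (g (Suc k)))\<^sup>2)) \<le> M" if "q < 0" for q
    using b c that large[of N]
    by (intro weighted_energy_bound[OF _ E_nonneg E_step]) auto
  have E_weighted: "\<exists>M. \<forall>k\<ge>N. real k powr q * E k \<le> M" if q: "q < 0" for q
  proof -
    obtain M where M: "\<And>n. n \<ge> N \<Longrightarrow> real n powr q * E n
      + (\<Sum>k=N..<n. real k powr q * ((real k)\<^sup>2 / 4 * (norm (g (Suc k)))\<^sup>2)) \<le> M"
      using weighted[OF q] by blast
    have "real n powr q * E n \<le> M" if "n \<ge> N" for n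
    proof -
      have "0 \<le> (\<Sum>k=N..<n. real k powr q * ((real k)\<^sup>2 / 4 * (norm (g (Suc k)))\<^sup>2))"
        by (intro sum_nonneg) simp
      with M[OF that] show ?thesis by linarith
    qed
    then show ?thesis by blast
  qed
  have transfer: "\<exists>M. \<forall>k\<ge>N. real k powr q * ((real k)\<^sup>2 * a k) \<le> M"
    if q: "q < 0" and C: "C \<ge> 0" "\<And>k. k \<ge> N \<Longrightarrow> (real k)\<^sup>2 * a k \<le> C * E k"
    for q C and a :: "nat \<Rightarrow> real"
  proof -
    obtain M where M: "\<And>k. k \<ge> N \<Longrightarrow> real k powr q * E k \<le> M"
      using E_weighted[OF q] by blast
    have "real k powr q * ((real k)\<^sup>2 * a k) \<le> C * M" if k: "k \<ge> N" for k
    proof -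
      have "real k powr q * ((real k)\<^sup>2 * a k) \<le> real k powr q * (C * E k)"
        using C(2)[OF k] by (intro mult_left_mono) auto
      also have "\<dots> = C * (real k powr q * E k)" by simp
      also have "\<dots> \<le> C * M" using M[OF k] C(1) by (rule mult_left_mono)
      finally show ?thesis .
    qed
    then show ?thesis by blast
  qed
  have \<phi>_le: "(real k)\<^sup>2 * \<phi> k \<le> 2 * E k" if "k \<ge> N" for k
    unfolding E_def using large[OF that] b c \<phi>_nonneg by (intro energy_controls_value) auto
  have d_le: "(real k)\<^sup>2 * (norm (d k))\<^sup>2 \<le> 16 * (1 + b / \<beta>) * E k" if "k \<ge> N" for k
    unfolding E_def \<beta>_def using large[OF that] b c \<phi>_nonneg
    by (intro energy_controls_velocity) auto
  have const: "0 \<le> 16 * (1 + b / \<beta>)" using b \<beta> by simp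
  show ?thesis
  proof (intro ballI)
    fix s :: real assume "s \<in> {1/2..<1}"
    then have s: "1/2 \<le> s" "s < 1" by auto
    note value_rates = rates_of_almost_quadratic_decay[OF \<phi>_nonneg s(2) transfer[OF _ _ \<phi>_le]]
    note velocity_rates = rates_of_almost_quadratic_decay[of "\<lambda>k. (norm (d k))\<^sup>2",
        OF _ s(2) transfer[OF _ const d_le]]
    obtain M where M: "\<And>n. n \<ge> N \<Longrightarrow> real n powr (2 * s - 2) * E n
        + (\<Sum>k=N..<n. real k powr (2 * s - 2) * ((real k)\<^sup>2 / 4 * (norm (g (Suc k)))\<^sup>2)) \<le> M"
      using weighted[of "2 * s - 2"] s by auto
    have "(\<Sum>k=N..<n. real k powr (2 * s - 2) * ((real k)\<^sup>2 / 4 * (norm (g (Suc k)))\<^sup>2)) \<le> M"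
      if "n \<ge> N" for n
    proof -
      have "0 \<le> real n powr (2 * s - 2) * E n" using E_nonneg[OF that] by simp
      with M[OF that] show ?thesis by linarith
    qed
    then have "summable (\<lambda>k. real k powr (2 * s - 2) * ((real k)\<^sup>2 / 4 * (norm (g (Suc k)))\<^sup>2))"
      by (intro summable_if_partial_sums_bounded_from[where N = N and M = M]) auto
    from summable_mult[OF this, of 4]
    have "summable (\<lambda>k. real k powr (2 * s - 2) * ((real k)\<^sup>2 * (norm (g (Suc k)))\<^sup>2))"
      by simp
    note grad_rates = rates_of_weighted_summability[of "\<lambda>k. (norm (g k))\<^sup>2", OF _ _ _ this]
    have "\<phi> \<in> o(\<lambda>k. real k powr (- 2 * s))"
      and "(\<lambda>k. real k powr (2 * s - 1) * \<phi> k) summable_on {1..}"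
      using value_rates by simp_all
    moreover have "(\<lambda>k. norm (d k)) \<in> o(\<lambda>k. real k powr (- s))"
      by (rule smallo_powr_of_power2, rule velocity_rates(1)) auto
    moreover have "(\<lambda>k. real k powr (2 * s - 1) * (norm (d k))\<^sup>2) summable_on {1..}"
      by (rule velocity_rates(2)) auto
    moreover have "(\<lambda>k. norm (g k)) \<in> o(\<lambda>k. real k powr (- s))"
      by (rule smallo_powr_of_power2, rule grad_rates(1)) (use s in auto)
    moreover have "(\<lambda>k. real k powr (2 * s) * (norm (g k))\<^sup>2) summable_on {1..}"
      by (rule grad_rates(2)) (use s in auto)
    ultimately show "((\<lambda>k. f (x k) - (INF z. f z)) \<in> o(\<lambda>k. real k powr (- 2 * s)) \<and>
       (\<lambda>k. norm (x k - x (k - 1))) \<in> o(\<lambda>k. real k powr (- s)) \<and>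
       (\<lambda>k. norm (gradient f (x k))) \<in> o(\<lambda>k. real k powr (- s))) \<and>
      (\<lambda>k. real k powr (2 * s - 1) * (f (x k) - (INF z. f z))) summable_on {1..} \<and>
      (\<lambda>k. real k powr (2 * s - 1) * (norm (x k - x (k - 1)))\<^sup>2) summable_on {1..} \<and>
      (\<lambda>k. real k powr (2 * s) * (norm (gradient f (x k)))\<^sup>2) summable_on {1..}"
      unfolding Inf_f \<phi>_def d_def g_def by blast
  qed
qed

end
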